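(* A nonempty set $S\subseteq\mathbb{Z}^n$ is multimodular if and only if there exist $a_I\in\mathbb{Z}\cup\{-\infty\}$ and $b_I\in\mathbb{Z}\cup\{+\infty\}$, indexed by the consecutive subsets $I$ of $N=\{1,\dots,n\}$, such that $$S=\{x\in\mathbb{Z}^n: a_I\le x(I)\le b_I\ \text{for every consecutive subset } I\subseteq N\}.$$
   Context: A subset $I\subseteq N$ is consecutive if $I=\{k,k+1,\dots,l\}$ for some $k\le l$. $x(I)=\sum_{i\in I}x_i$. A function $h$ on $\mathbb{Z}^m$ is submodular if $h(u)+h(v)\ge h(u\vee v)+h(u\wedge v)$ (componentwise max/min). A function $f:\mathbb{Z}^n\to\mathbb{R}\cup\{+\infty\}$ with nonempty effective domain is multimodular if $\tilde f(x_0,x)=f(x_1-x_0,x_2-x_1,\dots,x_n-x_{n-1})$ is submodular on $\mathbb{Z}^{n+1}$; a nonempty set is multimodular if its indicator function ($0$ on the set, $+\infty$ elsewhere) is multimodular. *)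

theory Defs
  imports
    Complex_Main
    "HOL-Library.FuncSet"
    "HOL-Library.Extended"
    "HOL-Library.Extended_Real"
begin

text \<open>
  Integer vectors with coordinates indexed by a set \<open>J\<close> of naturals are the extensional
  functions on \<open>J\<close>. Thus \<open>\<int>\<^sup>n\<close>, with coordinates \<open>x\<^sub>1, \<dots>, x\<^sub>n\<close>, is
  \<open>int_vecs {1..n}\<close>, and \<open>\<int>\<^sup>n\<^sup>+\<^sup>1\<close>, with coordinates \<open>x\<^sub>0, \<dots>, x\<^sub>n\<close>, is
  \<open>int_vecs {0..n}\<close>.
\<close>

definition int_vecs :: "nat set \<Rightarrow> (nat \<Rightarrow> int) set" where
  "int_vecs J = J \<rightarrow>\<^sub>E UNIV"

text \<open>
  \<open>sup\<close> and \<open>inf\<close> of functions into \<open>int\<close> are the componentwise maximum and minimum;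
  \<open>int_vecs J\<close> is closed under both.
\<close>

definition submodular_on :: "nat set \<Rightarrow> ((nat \<Rightarrow> int) \<Rightarrow> ereal) \<Rightarrow> bool" where
  "submodular_on J h \<longleftrightarrow>
    (\<forall>u \<in> int_vecs J. \<forall>v \<in> int_vecs J. h u + h v \<ge> h (sup u v) + h (inf u v))"

definition diff_transform :: "nat \<Rightarrow> ((nat \<Rightarrow> int) \<Rightarrow> ereal) \<Rightarrow> (nat \<Rightarrow> int) \<Rightarrow> ereal" where
  "diff_transform n f = (\<lambda>x. f (\<lambda>i\<in>{1..n}. x i - x (i - 1)))"

text \<open>
  The first conjunct says that \<open>f\<close> takes values in \<open>\<real> \<union> {+\<infinity>}\<close>, the second that its
  effective domain is nonempty. Values of \<open>f\<close> outside \<open>\<int>\<^sup>n\<close> are irrelevant.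
\<close>

definition multimodular_fun :: "nat \<Rightarrow> ((nat \<Rightarrow> int) \<Rightarrow> ereal) \<Rightarrow> bool" where
  "multimodular_fun n f \<longleftrightarrow>
    (\<forall>x \<in> int_vecs {1..n}. f x \<noteq> MInfty) \<and>
    (\<exists>x \<in> int_vecs {1..n}. f x \<noteq> PInfty) \<and>
    submodular_on {0..n} (diff_transform n f)"

definition indicator_fun :: "(nat \<Rightarrow> int) set \<Rightarrow> (nat \<Rightarrow> int) \<Rightarrow> ereal" where
  "indicator_fun S = (\<lambda>x. if x \<in> S then 0 else PInfty)"

definition multimodular_set :: "nat \<Rightarrow> (nat \<Rightarrow> int) set \<Rightarrow> bool" where
  "multimodular_set n S \<longleftrightarrow>
    S \<noteq> {} \<and> S \<subseteq> int_vecs {1..n} \<and> multimodular_fun n (indicator_fun S)"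

definition consecutive_subsets :: "nat \<Rightarrow> nat set set" where
  "consecutive_subsets n = {I. I \<subseteq> {1..n} \<and> (\<exists>k l. k \<le> l \<and> I = {k..l})}"

end

theory Submission
  imports Defs
begin

text \<open>
  Writing \<open>x\<^sub>i = p\<^sub>i - p\<^sub>i\<^sub>-\<^sub>1\<close>, the sums \<open>x(I)\<close> over consecutive \<open>I\<close> are the
  differences \<open>p\<^sub>j - p\<^sub>i\<close> with \<open>i < j\<close>, and \<open>S\<close> is multimodular iff the set \<open>D\<close> of all
  potentials \<open>p\<close> of elements of \<open>S\<close> is a sublattice. Bounds on differences are preserved by
  maxima and minima. Conversely, let \<open>D\<close> be a sublattice and let \<open>q\<close> satisfy all bounds on
  differences valid on \<open>D\<close>. As \<open>D\<close> is invariant under adding constants, for all \<open>i, j\<close>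
  some \<open>p\<^sup>i\<^sup>j \<in> D\<close> has value \<open>q\<^sub>i\<close> at \<open>i\<close> and value at least \<open>q\<^sub>j\<close> at \<open>j\<close>; hence
  \<open>q\<close> is the minimum over \<open>i\<close> of the maximum over \<open>j\<close> of the \<open>p\<^sup>i\<^sup>j\<close>.
\<close>

definition increments :: "nat \<Rightarrow> (nat \<Rightarrow> int) \<Rightarrow> nat \<Rightarrow> int" where
  "increments n p = (\<lambda>i\<in>{1..n}. p i - p (i - 1))"

lemma increments_in_int_vecs: "increments n p \<in> int_vecs {1..n}"
  by (simp add: increments_def int_vecs_def)

lemma increments_cong:
  assumes "\<And>i. i \<le> n \<Longrightarrow> p i = q i"
  shows "increments n p = increments n q"
  unfolding increments_def by (rule restrict_ext) (auto simp: assms)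

lemma increments_translate: "increments n (\<lambda>i. p i + c) = increments n p"
  by (simp add: increments_def)

text \<open>Makes \<open>increments n\<close> surjective onto \<open>int_vecs {1..n}\<close>: every
  vector has a potential, normalised to 0 at index 0 by the empty sum.\<close>

lemma increments_partial_sums:
  assumes "x \<in> int_vecs {1..n}"
  shows "increments n (\<lambda>i. \<Sum>k=1..i. x k) = x"
proof
  fix i
  show "increments n (\<lambda>i. \<Sum>k=1..i. x k) i = x i"
  proof (cases "i \<in> {1..n}")
    case True
    then obtain m where "i = Suc m" by (cases i) auto
    with True show ?thesis by (simp add: increments_def)
  next
    case False
    with assms show ?thesis
      by (auto simp: increments_def int_vecs_def PiE_def extensional_def)
  qed
qed

lemma sum_increments:
  assumes "j \<le> l" "l \<le> n"
  shows "(\<Sum>i=Suc j..l. increments n p i) = p l - p j"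
  using assms
proof (induction l rule: dec_induct)
  case base
  then show ?case by simp
next
  case (step m)
  then show ?case by (simp add: increments_def)
qed

lemma consecutive_subsets_eq:
  "consecutive_subsets n = {{Suc j..l} | j l. j < l \<and> l \<le> n}"
proof -
  have "\<exists>j l. {k..m} = {Suc j..l} \<and> j < l \<and> l \<le> n"
    if "{k..m} \<subseteq> {1..n}" "k \<le> m" for k m
    using that by (intro exI[of _ "k - 1"] exI[of _ m]) auto
  moreover have "{Suc j..l} \<subseteq> {1..n} \<and> Suc j \<le> l" if "j < l" "l \<le> n" for j l
    using that by auto
  ultimately show ?thesis
    unfolding consecutive_subsets_def by blast
qed

text \<open>An indicator takes only the values 0 and \<infinity>, so the submodular inequality bites
  only when both arguments have value 0, and then forces value 0 at their maximum and minimum. Since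
  \<open>increments n\<close> reads only the coordinates 0 to \<open>n\<close>, \<open>u\<close> and
  \<open>v\<close> may range over all functions instead of extensional ones.\<close>

lemma multimodular_set_iff:
  assumes "S \<subseteq> int_vecs {1..n}" "S \<noteq> {}"
  shows "multimodular_set n S \<longleftrightarrow>
    (\<forall>u v. increments n u \<in> S \<longrightarrow> increments n v \<in> S \<longrightarrow>
      increments n (sup u v) \<in> S \<and> increments n (inf u v) \<in> S)"
    (is "_ \<longleftrightarrow> ?lattice")
proof -
  have transform: "diff_transform n (indicator_fun S) p =
      (if increments n p \<in> S then 0 else PInfty)" for p
    by (simp add: diff_transform_def indicator_fun_def increments_def)
  have "multimodular_set n S \<longleftrightarrow> submodular_on {0..n} (diff_transform n (indicator_fun S))"
    using assms by (auto simp: multimodular_set_def multimodular_fun_def indicator_fun_def)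
  also have "\<dots> \<longleftrightarrow> (\<forall>u \<in> int_vecs {0..n}. \<forall>v \<in> int_vecs {0..n}.
      increments n u \<in> S \<longrightarrow> increments n v \<in> S \<longrightarrow>
      increments n (sup u v) \<in> S \<and> increments n (inf u v) \<in> S)"
    unfolding submodular_on_def transform by (auto split: if_splits)
  also have "\<dots> \<longleftrightarrow> ?lattice"
  proof (intro iffI allI impI)
    fix u v
    assume closed: "\<forall>u \<in> int_vecs {0..n}. \<forall>v \<in> int_vecs {0..n}.
      increments n u \<in> S \<longrightarrow> increments n v \<in> S \<longrightarrow>
      increments n (sup u v) \<in> S \<and> increments n (inf u v) \<in> S"
      and S: "increments n u \<in> S" "increments n v \<in> S"
    let ?u = "restrict u {0..n}" and ?v = "restrict v {0..n}"
    have restrict: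
      "increments n ?u = increments n u" "increments n ?v = increments n v"
      "increments n (sup ?u ?v) = increments n (sup u v)"
      "increments n (inf ?u ?v) = increments n (inf u v)"
      by (rule increments_cong; simp)+
    have "?u \<in> int_vecs {0..n}" "?v \<in> int_vecs {0..n}"
      by (simp_all add: int_vecs_def)
    with closed S show "increments n (sup u v) \<in> S \<and> increments n (inf u v) \<in> S"
      by (metis restrict)
  qed blast
  finally show ?thesis .
qed

lemma mem_sublattice_of_differences:
  fixes D :: "(nat \<Rightarrow> int) set" and q :: "nat \<Rightarrow> int"
  assumes sup: "\<And>u v. u \<in> D \<Longrightarrow> v \<in> D \<Longrightarrow> sup u v \<in> D"
    and inf: "\<And>u v. u \<in> D \<Longrightarrow> v \<in> D \<Longrightarrow> inf u v \<in> D"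
    and translate: "\<And>p c. p \<in> D \<Longrightarrow> (\<lambda>i. p i + c) \<in> D"
    and diff: "\<And>i j. i \<le> n \<Longrightarrow> j \<le> n \<Longrightarrow> \<exists>p\<in>D. q j - q i \<le> p j - p i"
  shows "\<exists>p\<in>D. \<forall>i\<le>n. p i = q i"
proof -
  have point: "\<exists>p\<in>D. p i = q i \<and> q j \<le> p j" if "i \<le> n" "j \<le> n" for i j
  proof -
    from diff[OF that] obtain p where "p \<in> D" "q j - q i \<le> p j - p i" by blast
    \<comment> \<open>The shift makes \<open>p\<close> agree with \<open>q\<close> at
      \<open>i\<close>, which turns the bound on the difference into a bound at
      \<open>j\<close>.\<close>
    with translate[of p "q i - p i"] show ?thesis
      by (intro bexI[of _ "\<lambda>k. p k + (q i - p i)"]) auto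
  qed
  have upper: "\<exists>p\<in>D. p i = q i \<and> (\<forall>j\<le>m. q j \<le> p j)" if "i \<le> n" "m \<le> n" for i m
    using \<open>m \<le> n\<close>
  proof (induction m)
    case 0
    with point[OF \<open>i \<le> n\<close>, of 0] show ?case by simp
  next
    case (Suc m)
    then obtain p where p: "p \<in> D" "p i = q i" "\<forall>j\<le>m. q j \<le> p j" by auto
    from point[OF \<open>i \<le> n\<close> Suc.prems] obtain p'
      where p': "p' \<in> D" "p' i = q i" "q (Suc m) \<le> p' (Suc m)" by blast
    have "q j \<le> sup p p' j" if "j \<le> Suc m" for j
      using that p(3) p'(3) by (cases "j = Suc m") (auto simp: le_Suc_eq le_max_iff_disj sup_max)
    with sup[OF p(1) p'(1)] p(2) p'(2) show ?case
      by (intro bexI[of _ "sup p p'"]) auto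
  qed
  \<comment> \<open>The second conjunct keeps each further minimum from falling below
    \<open>q\<close> where equality has already been reached.\<close>
  have "\<exists>p\<in>D. (\<forall>i\<le>m. p i = q i) \<and> (\<forall>j\<le>n. q j \<le> p j)" if "m \<le> n" for m
    using that
  proof (induction m)
    case 0
    with upper[of 0 n] show ?case by simp
  next
    case (Suc m)
    then obtain p where p: "p \<in> D" "\<forall>i\<le>m. p i = q i" "\<forall>j\<le>n. q j \<le> p j" by auto
    from upper[OF Suc.prems order_refl] obtain p'
      where p': "p' \<in> D" "p' (Suc m) = q (Suc m)" "\<forall>j\<le>n. q j \<le> p' j" by blast
    have "inf p p' i = q i" if "i \<le> Suc m" for i
    proof -
      have "i \<le> n" using that Suc.prems by simp
      then show ?thesis
        using that p(2,3) p'(2,3) by (auto simp: le_Suc_eq inf_min min_def intro: antisym)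
    qed
    with inf[OF p(1) p'(1)] p(3) p'(3) show ?case
      by (intro bexI[of _ "inf p p'"]) auto
  qed
  then show ?thesis by blast
qed

text \<open>\<open>b\<close> is the supremum of \<open>A\<close>. A nonempty set of integers bounded
  above attains its supremum, so any \<open>z\<close> below \<open>b\<close> has a witness in
  \<open>A\<close>; this is how the bounds in the theorem yield elements of
  \<open>S\<close>.\<close>

lemma extended_upper_bound_int:
  fixes A :: "int set"
  assumes "A \<noteq> {}"
  shows "\<exists>b. b \<noteq> Minf \<and> (\<forall>z. Fin z \<le> b \<longleftrightarrow> (\<exists>y\<in>A. z \<le> y))"
proof (cases "bdd_above A")
  case True
  then obtain c where c: "\<And>y. y \<in> A \<Longrightarrow> y \<le> c" by (auto simp: bdd_above_def)
  \<comment> \<open>The maximum of \<open>A\<close> is the element at least distance from the upper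
    bound \<open>c\<close>.\<close>
  obtain y where y: "y \<in> A" "\<And>w. w \<in> A \<Longrightarrow> nat (c - y) \<le> nat (c - w)"
    using assms ex_has_least_nat[of "\<lambda>y. y \<in> A" _ "\<lambda>y. nat (c - y)"] by blast
  have "w \<le> y" if "w \<in> A" for w
    using y(2)[OF that] c[OF that] c[OF y(1)] by linarith
  with y(1) have "Fin z \<le> Fin y \<longleftrightarrow> (\<exists>y\<in>A. z \<le> y)" for z
    by force
  then show ?thesis by (intro exI[of _ "Fin y"]) simp
next
  case False
  then have "\<exists>y\<in>A. z \<le> y" for z
    by (meson bdd_aboveI linear)
  then show ?thesis by (intro exI[of _ Pinf]) simp
qed

lemma extended_lower_bound_int:
  fixes A :: "int set"
  assumes "A \<noteq> {}"
  shows "\<exists>a. a \<noteq> Pinf \<and> (\<forall>z. a \<le> Fin z \<longleftrightarrow> (\<exists>y\<in>A. y \<le> z))"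
proof -
  from assms obtain b where b: "b \<noteq> Minf"
    "\<And>z. Fin z \<le> b \<longleftrightarrow> (\<exists>y\<in>uminus ` A. z \<le> y)"
    using extended_upper_bound_int[of "uminus ` A"] by auto
  have "- b \<le> Fin z \<longleftrightarrow> Fin (- z) \<le> b" for z
    by (cases b) auto
  then have "- b \<le> Fin z \<longleftrightarrow> (\<exists>y\<in>A. y \<le> z)" for z
    using b(2)[of "- z"] by auto
  moreover have "- b \<noteq> Pinf"
    using b(1) by (cases b) auto
  ultimately show ?thesis by blast
qed

theorem theorem5p5:
  fixes n :: nat and S :: "(nat \<Rightarrow> int) set"
  assumes "S \<subseteq> int_vecs {1..n}" and "S \<noteq> {}"
  shows "multimodular_set n S \<longleftrightarrow>
    (\<exists>(a :: nat set \<Rightarrow> int extended) (b :: nat set \<Rightarrow> int extended).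
      (\<forall>I \<in> consecutive_subsets n. a I \<noteq> Pinf \<and> b I \<noteq> Minf) \<and>
      S = {x \<in> int_vecs {1..n}. \<forall>I \<in> consecutive_subsets n.
             a I \<le> Fin (\<Sum>i\<in>I. x i) \<and> Fin (\<Sum>i\<in>I. x i) \<le> b I})"
    (is "_ \<longleftrightarrow> (\<exists>a b. ?finite a b \<and> S = ?box a b)")
proof
  assume "multimodular_set n S"
  then have lattice: "increments n (sup u v) \<in> S" "increments n (inf u v) \<in> S"
    if "increments n u \<in> S" "increments n v \<in> S" for u v
    using that multimodular_set_iff[OF assms] by blast+
  let ?sums = "\<lambda>I. (\<lambda>x. \<Sum>i\<in>I. x i) ` S"
  have nonempty: "?sums I \<noteq> {}" for I using assms(2) by simp
  have "\<forall>I. \<exists>a. a \<noteq> Pinf \<and> (\<forall>z. a \<le> Fin z \<longleftrightarrow> (\<exists>y\<in>?sums I. y \<le> z))"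
    by (intro allI extended_lower_bound_int nonempty)
  from choice[OF this] obtain a :: "nat set \<Rightarrow> int extended" where
    a: "\<And>I. a I \<noteq> Pinf" "\<And>I z. a I \<le> Fin z \<longleftrightarrow> (\<exists>y\<in>?sums I. y \<le> z)" by blast
  have "\<forall>I. \<exists>b. b \<noteq> Minf \<and> (\<forall>z. Fin z \<le> b \<longleftrightarrow> (\<exists>y\<in>?sums I. z \<le> y))"
    by (intro allI extended_upper_bound_int nonempty)
  from choice[OF this] obtain b :: "nat set \<Rightarrow> int extended" where
    b: "\<And>I. b I \<noteq> Minf" "\<And>I z. Fin z \<le> b I \<longleftrightarrow> (\<exists>y\<in>?sums I. z \<le> y)" by blast
  have "x \<in> S" if "x \<in> ?box a b" for x
  proof -
    let ?D = "{p. increments n p \<in> S}"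
    define q where "q = (\<lambda>i. \<Sum>k=1..i. x k)"
    have x: "x = increments n q"
      using that increments_partial_sums[of x n] by (simp add: q_def)
    have potential: "\<exists>p\<in>?D. y = increments n p" if "y \<in> S" for y
    proof -
      from that assms(1) have "increments n (\<lambda>i. \<Sum>k=1..i. y k) = y"
        by (intro increments_partial_sums) blast
      with that show ?thesis by (metis mem_Collect_eq)
    qed
    have interval: "(\<exists>p\<in>?D. p j - p i \<le> q j - q i) \<and> (\<exists>p\<in>?D. q j - q i \<le> p j - p i)"
      if "i < j" "j \<le> n" for i j
    proof -
      have sum: "(\<Sum>k=Suc i..j. increments n p k) = p j - p i" for p
        using that by (simp add: sum_increments)
      have "{Suc i..j} \<in> consecutive_subsets n"
        using that by (auto simp: consecutive_subsets_eq)
      with \<open>x \<in> ?box a b\<close> have "a {Suc i..j} \<le> Fin (q j - q i)" "Fin (q j - q i) \<le> b {Suc i..j}"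
        unfolding x sum[of q, symmetric] by blast+
      then obtain y y' where
        y: "y \<in> S" "(\<Sum>k=Suc i..j. y k) \<le> q j - q i" and
        y': "y' \<in> S" "q j - q i \<le> (\<Sum>k=Suc i..j. y' k)"
        unfolding a(2) b(2) by blast
      from y(2) potential[OF y(1)] have "\<exists>p\<in>?D. p j - p i \<le> q j - q i"
        by (auto simp: sum)
      moreover from y'(2) potential[OF y'(1)] have "\<exists>p\<in>?D. q j - q i \<le> p j - p i"
        by (auto simp: sum)
      ultimately show ?thesis ..
    qed
    \<comment> \<open>For \<open>i < j\<close> this is the upper bound on the sum; for
      \<open>i > j\<close> it is the lower bound with signs reversed; for \<open>i = j\<close> it
      only asks that \<open>?D\<close> be nonempty.\<close>
    have "\<exists>p\<in>?D. q j - q i \<le> p j - p i" if "i \<le> n" "j \<le> n" for i j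
    proof (cases i j rule: linorder_cases)
      case less
      with interval that show ?thesis by blast
    next
      case equal
      with assms(2) potential show ?thesis by auto
    next
      case greater
      with interval[of j i] that show ?thesis by force
    qed
    then have "\<exists>p\<in>?D. \<forall>i\<le>n. p i = q i"
      by (intro mem_sublattice_of_differences) (simp_all add: lattice increments_translate)
    then obtain p where "increments n p \<in> S" "\<And>i. i \<le> n \<Longrightarrow> p i = q i" by blast
    then show ?thesis
      unfolding x by (metis increments_cong)
  qed
  moreover have "S \<subseteq> ?box a b"
    using assms(1) by (auto simp: a(2) b(2))
  ultimately have "S = ?box a b" by blast
  moreover have "?finite a b" using a(1) b(1) by blast
  ultimately show "\<exists>a b. ?finite a b \<and> S = ?box a b"
    by (intro exI conjI)
next
  assume "\<exists>a b. ?finite a b \<and> S = ?box a b"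
  then obtain a b where S: "S = ?box a b" by (elim exE conjE)
  have mem: "increments n p \<in> S \<longleftrightarrow>
      (\<forall>j l. j < l \<and> l \<le> n \<longrightarrow>
        a {Suc j..l} \<le> Fin (p l - p j) \<and> Fin (p l - p j) \<le> b {Suc j..l})" for p
  proof -
    have "increments n p \<in> S \<longleftrightarrow> (\<forall>j l. j < l \<and> l \<le> n \<longrightarrow>
        a {Suc j..l} \<le> Fin (\<Sum>i=Suc j..l. increments n p i) \<and>
        Fin (\<Sum>i=Suc j..l. increments n p i) \<le> b {Suc j..l})"
      unfolding S consecutive_subsets_eq using increments_in_int_vecs by blast
    then show ?thesis by (auto simp: sum_increments)
  qed
  \<comment> \<open>Intervals with possibly infinite ends are convex.\<close>
  have between: "lo \<le> Fin w \<and> Fin w \<le> hi"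
    if "lo \<le> Fin y" "Fin y \<le> hi" "lo \<le> Fin z" "Fin z \<le> hi" "min y z \<le> w" "w \<le> max y z"
    for lo hi :: "int extended" and w y z
    using that by (cases lo; cases hi) auto
  have "increments n (sup u v) \<in> S \<and> increments n (inf u v) \<in> S"
    if "increments n u \<in> S" "increments n v \<in> S" for u v
  proof -
    \<comment> \<open>If the maximum at \<open>l\<close> comes from \<open>u\<close>, the difference
      for \<open>sup u v\<close> is at most that of \<open>u\<close>; if the maximum at
      \<open>j\<close> comes from \<open>u\<close>, it is at least that of \<open>u\<close>. The
      same holds for \<open>v\<close>, and dually for \<open>inf u v\<close>.\<close>
    have "a {Suc j..l} \<le> Fin (w l - w j) \<and> Fin (w l - w j) \<le> b {Suc j..l}"
      if "j < l" "l \<le> n" "w = sup u v \<or> w = inf u v" for j l w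
    proof (rule between)
      show "min (u l - u j) (v l - v j) \<le> w l - w j" "w l - w j \<le> max (u l - u j) (v l - v j)"
        using that(3) by (auto simp: sup_max inf_min min_def max_def)
    qed (use that(1,2) \<open>increments n u \<in> S\<close> \<open>increments n v \<in> S\<close> mem in blast)+
    then show ?thesis unfolding mem by blast
  qed
  then show "multimodular_set n S"
    using multimodular_set_iff[OF assms] by blast
qed

end
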